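(* Let $\varepsilon>0$ and let $v\in H^1(\Omega)$ be such that $-\varepsilon^2\triangle v+v\neq 0$. Then there exists $\gamma\in(0,1)$ such that $$\inf_{w\in H_0^1(\Omega)}\frac{\varepsilon^2|v-w|_1^2+\|v-w\|^2}{\varepsilon^2|v|_1^2+\|v\|^2}\le\gamma.$$
   Context: $\Omega\subset\mathbb{R}^d$, $d\in\{2,3\}$, is a bounded polygonal ($d=2$) or polyhedral ($d=3$) domain with Lipschitz boundary. $\|\cdot\|$ is the $L^2(\Omega)$ norm and $|v|_1=\|\nabla v\|$ is the $H^1(\Omega)$ seminorm. The operator $-\varepsilon^2\triangle v+v$ is understood in the weak sense: $-\varepsilon^2\triangle v+v=0$ means $\int_\Omega(\varepsilon^2\nabla v\cdot\nabla\phi+v\phi)\,d\mathbf{x}=0$ for all $\phi\in H_0^1(\Omega)$, and $\neq0$ means that this fails. *)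

theory Defs
  imports "HOL-Analysis.Analysis"
begin

section \<open>Polyhedral Lipschitz domains\<close>

text \<open>A face of a polyhedral domain need not be convex; it is then a union of several of
  the flat pieces below.\<close>

definition polyhedral_boundary :: "'a::euclidean_space set \<Rightarrow> bool" where
  "polyhedral_boundary S \<longleftrightarrow>
    (\<exists>F. finite F \<and> (\<forall>P\<in>F. polytope P \<and> aff_dim P = int DIM('a) - 1) \<and> frontier S = \<Union>F)"

text \<open>Near each boundary point, the set is the strict epigraph of a Lipschitz function, in
  orthogonal coordinates with vertical direction \<open>e\<close>. The horizontal coordinates of \<open>y\<close> are
  represented by its projection \<open>y - (y \<bullet> e) *\<^sub>R e\<close> onto the hyperplane orthogonal to \<open>e\<close>.\<close>

definition lipschitz_boundary :: "'a::euclidean_space set \<Rightarrow> bool" where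
  "lipschitz_boundary S \<longleftrightarrow>
    (\<forall>x \<in> frontier S. \<exists>U e g L.
        open U \<and> x \<in> U \<and> norm e = 1 \<and> L-lipschitz_on {z. z \<bullet> e = 0} g \<and>
        S \<inter> U = {y \<in> U. g (y - (y \<bullet> e) *\<^sub>R e) < y \<bullet> e})"

section \<open>Test functions\<close>

definition partial_deriv :: "'a \<Rightarrow> ('a::euclidean_space \<Rightarrow> real) \<Rightarrow> 'a \<Rightarrow> real" where
  "partial_deriv b f x = frechet_derivative f (at x) b"

definition grad :: "('a::euclidean_space \<Rightarrow> real) \<Rightarrow> 'a \<Rightarrow> 'a" where
  "grad f x = (\<Sum>b\<in>Basis. partial_deriv b f x *\<^sub>R b)"

primrec C_k :: "nat \<Rightarrow> ('a::euclidean_space \<Rightarrow> real) \<Rightarrow> bool" where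
  "C_k 0 f \<longleftrightarrow> continuous_on UNIV f"
| "C_k (Suc k) f \<longleftrightarrow> (\<forall>x. f differentiable (at x)) \<and> (\<forall>b\<in>Basis. C_k k (partial_deriv b f))"

text \<open>Elements of \<open>C\<^sub>c\<^sup>\<infinity>(\<Omega>)\<close> are represented by their extension by zero to the whole space.\<close>

definition test_functions :: "'a::euclidean_space set \<Rightarrow> ('a \<Rightarrow> real) set" where
  "test_functions \<Omega> = {\<phi>. (\<forall>k. C_k k \<phi>) \<and> compact (closure {x. \<phi> x \<noteq> 0}) \<and>
     closure {x. \<phi> x \<noteq> 0} \<subseteq> \<Omega>}"

section \<open>Lebesgue and Sobolev spaces\<close>

text \<open>Elements of the function spaces are represented by functions on the whole space. Only
  their values on \<open>\<Omega>\<close> matter, and these only up to null sets.\<close>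

definition L2_space :: "'a::euclidean_space set \<Rightarrow> ('a \<Rightarrow> 'b::euclidean_space) set" where
  "L2_space \<Omega> = {f. f \<in> borel_measurable (lebesgue_on \<Omega>) \<and>
     integrable (lebesgue_on \<Omega>) (\<lambda>x. (norm (f x))\<^sup>2)}"

definition L2_norm :: "'a::euclidean_space set \<Rightarrow> ('a \<Rightarrow> 'b::euclidean_space) \<Rightarrow> real" where
  "L2_norm \<Omega> f = sqrt (integral\<^sup>L (lebesgue_on \<Omega>) (\<lambda>x. (norm (f x))\<^sup>2))"

definition is_weak_grad ::
    "'a::euclidean_space set \<Rightarrow> ('a \<Rightarrow> real) \<Rightarrow> ('a \<Rightarrow> 'a) \<Rightarrow> bool" where
  "is_weak_grad \<Omega> v G \<longleftrightarrow>
    (\<forall>\<phi>\<in>test_functions \<Omega>.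
       integral\<^sup>L (lebesgue_on \<Omega>) (\<lambda>x. v x *\<^sub>R grad \<phi> x) =
       - integral\<^sup>L (lebesgue_on \<Omega>) (\<lambda>x. \<phi> x *\<^sub>R G x))"

definition H1 :: "'a::euclidean_space set \<Rightarrow> ('a \<Rightarrow> real) set" where
  "H1 \<Omega> = {v \<in> L2_space \<Omega>. \<exists>G\<in>L2_space \<Omega>. is_weak_grad \<Omega> v G}"

text \<open>For \<open>v \<in> H1 \<Omega>\<close> with \<open>\<Omega>\<close> open, the weak gradient is unique up to null sets, so the
  choice of a representative does not affect the integrals below.\<close>

definition weak_grad :: "'a::euclidean_space set \<Rightarrow> ('a \<Rightarrow> real) \<Rightarrow> 'a \<Rightarrow> 'a" where
  "weak_grad \<Omega> v = (SOME G. G \<in> L2_space \<Omega> \<and> is_weak_grad \<Omega> v G)"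

definition H1_seminorm :: "'a::euclidean_space set \<Rightarrow> ('a \<Rightarrow> real) \<Rightarrow> real" where
  "H1_seminorm \<Omega> v = L2_norm \<Omega> (weak_grad \<Omega> v)"

definition H1_norm :: "'a::euclidean_space set \<Rightarrow> ('a \<Rightarrow> real) \<Rightarrow> real" where
  "H1_norm \<Omega> v = sqrt ((L2_norm \<Omega> v)\<^sup>2 + (H1_seminorm \<Omega> v)\<^sup>2)"

text \<open>\<open>H\<^sub>0\<^sup>1(\<Omega>)\<close> is the closure of \<open>C\<^sub>c\<^sup>\<infinity>(\<Omega>)\<close> in \<open>H\<^sup>1(\<Omega>)\<close>.\<close>

definition H1_0 :: "'a::euclidean_space set \<Rightarrow> ('a \<Rightarrow> real) set" where
  "H1_0 \<Omega> = {w \<in> H1 \<Omega>. \<forall>\<delta>>0. \<exists>\<phi>\<in>test_functions \<Omega>. H1_norm \<Omega> (\<lambda>x. w x - \<phi> x) < \<delta>}"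

text \<open>The equation \<open>-\<epsilon>\<^sup>2 \<triangle>v + v = 0\<close> in the weak sense.\<close>

definition weak_solution :: "'a::euclidean_space set \<Rightarrow> real \<Rightarrow> ('a \<Rightarrow> real) \<Rightarrow> bool" where
  "weak_solution \<Omega> \<epsilon> v \<longleftrightarrow>
    (\<forall>\<phi>\<in>H1_0 \<Omega>.
       integral\<^sup>L (lebesgue_on \<Omega>)
         (\<lambda>x. \<epsilon>\<^sup>2 * (weak_grad \<Omega> v x \<bullet> weak_grad \<Omega> \<phi> x) + v x * \<phi> x) = 0)"

end

theory Submission
  imports Defs
begin

text \<open>
  Write \<open>E(u) = \<epsilon>\<^sup>2 |u|\<^sub>1\<^sup>2 + \<parallel>u\<parallel>\<^sup>2\<close> and let \<open>B\<close> be the symmetric bilinear form that polarises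
  \<open>E\<close>. If \<open>v\<close> is not a weak solution, some \<open>\<phi> \<in> H\<^sub>0\<^sup>1(\<Omega>)\<close> has \<open>B(v, \<phi>) \<noteq> 0\<close>, and in the expansion
  \<open>E(v - t \<phi>) = E(v) - 2 t B(v, \<phi>) + t\<^sup>2 E(\<phi>)\<close> the linear term wins for small \<open>t\<close> of the
  sign of \<open>B(v, \<phi>)\<close>. Hence \<open>E(v - w) < E(v)\<close> for \<open>w = t \<phi> \<in> H\<^sub>0\<^sup>1(\<Omega>)\<close>. Since
  \<open>E(v - w) \<ge> 0\<close>, this also gives \<open>E(v) > 0\<close>, so the quotient at \<open>w\<close> is below \<open>1\<close>
  and bounds the infimum.

  The expansion (lemma \<open>energy_diff_scaleR\<close>) and the stability of \<open>H\<^sub>0\<^sup>1(\<Omega>)\<close> under scaling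
  (lemma \<open>H1_0_cmult\<close>) rest on the linearity of the weak gradient. As the weak gradient is a
  choice among all candidates, linearity holds only almost everywhere, and only because two
  candidates agree almost everywhere. That is the fundamental lemma of the calculus of variations
  (\<open>AE_eq_0_if_weakly_0\<close>): smooth bumps increase to the indicator of a box, so a function that
  annihilates all test functions has integral zero over every box inside \<open>\<Omega>\<close>, and by
  Lebesgue's differentiation theorem it vanishes almost everywhere.

  Scaling in \<open>H\<^sub>0\<^sup>1(\<Omega>)\<close> also needs test functions to lie in \<open>H\<^sup>1(\<Omega>)\<close>, because otherwise the
  seminorm of \<open>w - \<phi>\<close> would be that of an unspecified function. This is integration by parts
  (\<open>is_weak_grad_grad\<close>), which follows from the translation invariance of Lebesgue measure.
\<close>

section \<open>Smooth bump functions\<close>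

text \<open>The polynomial factor makes the family closed under differentiation; \<open>p = 1\<close> is the classical
  smooth function that is flat at \<open>0\<close>.\<close>

definition exp_flat :: "real poly \<Rightarrow> real \<Rightarrow> real" where
  "exp_flat p t = (if t > 0 then poly p (1 / t) * exp (- (1 / t)) else 0)"

lemma exp_flat_tendsto_0_at_right: "(exp_flat p \<longlongrightarrow> 0) (at_right 0)"
proof -
  have "((\<lambda>x. poly p x / exp x) \<longlongrightarrow> 0) at_top"
  proof -
    have "((\<lambda>x. \<Sum>i\<le>degree p. coeff p i * (x ^ i / exp x)) \<longlongrightarrow> (\<Sum>i\<le>degree p. coeff p i * 0)) at_top"
      by (rule tendsto_sum, rule tendsto_mult[OF tendsto_const tendsto_power_div_exp_0])
    then show ?thesis
      by (simp only: poly_altdef sum_divide_distrib times_divide_eq_right mult_zero_right sum.neutral_const)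
  qed
  moreover have "\<forall>\<^sub>F x in at_top. poly p x / exp x = exp_flat p (inverse x)"
    using eventually_gt_at_top[of 0]
    by eventually_elim (simp add: exp_flat_def exp_minus field_simps)
  ultimately have "((\<lambda>x. exp_flat p (inverse x)) \<longlongrightarrow> 0) at_top"
    by (rule Lim_transform_eventually)
  then show ?thesis
    by (simp only: filterlim_at_right_to_top)
qed

text \<open>Away from \<open>0\<close> this is the chain rule, since \<open>1 / t\<close> has derivative \<open>- (1 / t)\<^sup>2\<close>. At \<open>0\<close> the
  right-hand difference quotient is again a member of the family, so it tends to \<open>0\<close>.\<close>

lemma DERIV_exp_flat:
  "(exp_flat p has_real_derivative exp_flat (monom 1 2 * (p - pderiv p)) t) (at t)"
proof -
  consider "t > 0" | "t < 0" | "t = 0" by linarith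
  then show ?thesis
  proof cases
    case 1
    have inv: "((\<lambda>s. 1 / s) has_real_derivative - (1 / t ^ 2)) (at t)"
      using 1 by (auto intro!: derivative_eq_intros simp: power2_eq_square)
    have "((\<lambda>s. poly p (1 / s) * exp (- (1 / s))) has_real_derivative
        poly p (1 / t) * (exp (- (1 / t)) * - (- (1 / t ^ 2))) +
        poly (pderiv p) (1 / t) * - (1 / t ^ 2) * exp (- (1 / t))) (at t)"
      by (intro DERIV_mult' DERIV_chain'[OF inv poly_DERIV] DERIV_fun_exp DERIV_minus inv)
    also have "poly p (1 / t) * (exp (- (1 / t)) * - (- (1 / t ^ 2))) +
        poly (pderiv p) (1 / t) * - (1 / t ^ 2) * exp (- (1 / t)) =
        exp_flat (monom 1 2 * (p - pderiv p)) t"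
      using 1 by (simp add: exp_flat_def poly_monom power_one_over algebra_simps)
    finally have "((\<lambda>s. poly p (1 / s) * exp (- (1 / s))) has_real_derivative
        exp_flat (monom 1 2 * (p - pderiv p)) t) (at t)" .
    then show ?thesis
      by (rule has_field_derivative_transform_within_open[where S = "{0<..}"])
        (use 1 in \<open>auto simp: exp_flat_def\<close>)
  next
    case 2
    have "((\<lambda>s. 0) has_real_derivative exp_flat (monom 1 2 * (p - pderiv p)) t) (at t)"
      using 2 by (simp add: exp_flat_def)
    then show ?thesis
      by (rule has_field_derivative_transform_within_open[where S = "{..<0}"])
        (use 2 in \<open>auto simp: exp_flat_def\<close>)
  next
    case 3
    have "((\<lambda>h. exp_flat p h / h) \<longlongrightarrow> 0) (at_right 0)"
    proof (rule Lim_transform_eventually[OF exp_flat_tendsto_0_at_right[of "monom 1 1 * p"]])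
      show "\<forall>\<^sub>F h in at_right 0. exp_flat (monom 1 1 * p) h = exp_flat p h / h"
        using eventually_at_right_less[of 0]
        by eventually_elim (simp add: exp_flat_def poly_monom)
    qed
    moreover have "((\<lambda>h. exp_flat p h / h) \<longlongrightarrow> 0) (at_left 0)"
    proof (rule tendsto_eventually)
      have "\<forall>\<^sub>F h in at_left 0. h \<in> {- 1 <..< (0::real)}"
        by (rule eventually_at_leftI[of "-1"]) auto
      then show "\<forall>\<^sub>F h in at_left 0. exp_flat p h / h = 0"
        by eventually_elim (simp add: exp_flat_def)
    qed
    ultimately have "((\<lambda>h. exp_flat p h / h) \<longlongrightarrow> 0) (at 0)"
      by (simp add: filterlim_at_split)
    then show ?thesis
      unfolding 3 DERIV_def by (simp add: exp_flat_def)
  qed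
qed

text \<open>Closure under sums and products makes this set closed under partial derivatives, which is the
  invariant from which smoothness of all orders follows by coinduction.\<close>

inductive_set bump_algebra :: "('a::euclidean_space \<Rightarrow> real) set" where
  const: "(\<lambda>x. c) \<in> bump_algebra"
| ridge: "(\<lambda>x. exp_flat p (x \<bullet> u + c)) \<in> bump_algebra"
| add: "f \<in> bump_algebra \<Longrightarrow> g \<in> bump_algebra \<Longrightarrow> (\<lambda>x. f x + g x) \<in> bump_algebra"
| mult: "f \<in> bump_algebra \<Longrightarrow> g \<in> bump_algebra \<Longrightarrow> (\<lambda>x. f x * g x) \<in> bump_algebra"

lemma partial_deriv_eqI:
  assumes "\<And>x. (f has_derivative f' x) (at x)"
  shows "partial_deriv b f = (\<lambda>x. f' x b)"
  using frechet_derivative_at[OF assms] by (simp add: partial_deriv_def fun_eq_iff)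

lemma partial_deriv_mult:
  fixes f g :: "'a::euclidean_space \<Rightarrow> real"
  assumes "\<And>x. f differentiable (at x)" "\<And>x. g differentiable (at x)"
  shows "partial_deriv b (\<lambda>x. f x * g x) = (\<lambda>x. f x * partial_deriv b g x + partial_deriv b f x * g x)"
  unfolding partial_deriv_def[of b f] partial_deriv_def[of b g]
  by (rule partial_deriv_eqI)
    (intro has_derivative_mult assms[THEN frechet_derivative_works[THEN iffD1]])

lemma bump_algebra_closed_partial_deriv:
  assumes "f \<in> bump_algebra"
  shows "(\<forall>x. f differentiable (at x)) \<and> partial_deriv b f \<in> bump_algebra"
  using assms
proof induction
  case (const c)
  have "partial_deriv b (\<lambda>x::'a. c) = (\<lambda>x. 0)"
    by (rule partial_deriv_eqI) (rule has_derivative_const)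
  then show ?case by (auto intro: bump_algebra.const)
next
  case (ridge p u c)
  let ?q = "monom 1 2 * (p - pderiv p)"
  have *: "((\<lambda>x. exp_flat p (x \<bullet> u + c)) has_derivative
      (\<lambda>h. exp_flat ?q (x \<bullet> u + c) * (h \<bullet> u))) (at x)" for x
    by (rule DERIV_compose_FDERIV[OF DERIV_exp_flat, THEN has_derivative_eq_rhs])
      (auto intro!: derivative_eq_intros simp: mult.commute)
  have "partial_deriv b (\<lambda>x. exp_flat p (x \<bullet> u + c)) = (\<lambda>x. exp_flat ?q (x \<bullet> u + c) * (b \<bullet> u))"
    by (rule partial_deriv_eqI[OF *])
  then show ?case
    using * by (auto intro: differentiableI bump_algebra.intros)
next
  case (add f g)
  then have "partial_deriv b (\<lambda>x. f x + g x) = (\<lambda>x. partial_deriv b f x + partial_deriv b g x)"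
    unfolding partial_deriv_def[of b f] partial_deriv_def[of b g]
    by (intro partial_deriv_eqI has_derivative_add) (simp_all flip: frechet_derivative_works)
  then show ?case
    using add by (auto intro: bump_algebra.intros)
next
  case (mult f g)
  then show ?case
    by (auto simp: partial_deriv_mult intro: bump_algebra.intros)
qed

text \<open>A set that is stable under partial derivatives replaces explicit formulas for the derivatives of
  higher order.\<close>

lemma C_k_coinduct:
  assumes "f \<in> A"
    and "\<And>f. f \<in> A \<Longrightarrow> (\<forall>x. f differentiable (at x)) \<and> (\<forall>b\<in>Basis. partial_deriv b f \<in> A)"
  shows "C_k k f"
  using assms(1)
proof (induction k arbitrary: f)
  case 0
  then show ?case
    using assms(2) differentiable_imp_continuous_within continuous_on_eq_continuous_within
    by (metis C_k.simps(1))
next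
  case (Suc k)
  then show ?case using assms(2) by simp
qed

lemma prod_in_bump_algebra:
  assumes "finite I" "\<And>i. i \<in> I \<Longrightarrow> f i \<in> bump_algebra"
  shows "(\<lambda>x. \<Prod>i\<in>I. f i x) \<in> bump_algebra"
  using assms by (induction I) (auto intro: bump_algebra.intros)

text \<open>As \<open>n\<close> grows, each factor tends to \<open>1\<close> on its open half space and stays \<open>0\<close> on the
  complement. Thus rescaling alone approximates the indicator of the box, without a plateau
  construction.\<close>

definition box_bump :: "'a::euclidean_space \<Rightarrow> 'a \<Rightarrow> nat \<Rightarrow> 'a \<Rightarrow> real" where
  "box_bump a c n x = (\<Prod>b\<in>Basis. exp_flat 1 (real n * (x \<bullet> b - a \<bullet> b)) *
     exp_flat 1 (real n * (c \<bullet> b - x \<bullet> b)))"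

lemma C_k_box_bump: "C_k k (box_bump a c n)"
proof (rule C_k_coinduct)
  have 1: "(\<lambda>x. exp_flat 1 (real n * (x \<bullet> b - a \<bullet> b))) \<in> bump_algebra" for b :: 'a
    using bump_algebra.ridge[of 1 "real n *\<^sub>R b" "- (real n * (a \<bullet> b))"]
    by (simp add: right_diff_distrib)
  have 2: "(\<lambda>x. exp_flat 1 (real n * (c \<bullet> b - x \<bullet> b))) \<in> bump_algebra" for b :: 'a
    using bump_algebra.ridge[of 1 "- (real n *\<^sub>R b)" "real n * (c \<bullet> b)"]
    by (simp add: right_diff_distrib)
  have "(\<lambda>x. \<Prod>b\<in>Basis. exp_flat 1 (real n * (x \<bullet> b - a \<bullet> b)) *
      exp_flat 1 (real n * (c \<bullet> b - x \<bullet> b))) \<in> bump_algebra"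
    by (rule prod_in_bump_algebra[OF finite_Basis]) (rule bump_algebra.mult[OF 1 2])
  then show "box_bump a c n \<in> bump_algebra"
    by (simp only: box_bump_def[abs_def])
qed (simp add: bump_algebra_closed_partial_deriv)

lemma box_bump_eq_0:
  assumes "x \<notin> box a c"
  shows "box_bump a c n x = 0"
proof -
  obtain b where b: "b \<in> Basis" "\<not> (a \<bullet> b < x \<bullet> b \<and> x \<bullet> b < c \<bullet> b)"
    using assms by (auto simp: mem_box)
  have "real n * (x \<bullet> b - a \<bullet> b) \<le> 0 \<or> real n * (c \<bullet> b - x \<bullet> b) \<le> 0"
    using b(2) by (metis diff_le_0_iff_le linorder_not_le mult_nonneg_nonpos of_nat_0_le_iff)
  then show ?thesis
    unfolding box_bump_def
    by (intro prod_zero bexI[of _ b]) (auto simp: exp_flat_def b(1))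
qed

lemma box_bump_test_function:
  assumes "cbox a c \<subseteq> \<Omega>"
  shows "box_bump a c n \<in> test_functions \<Omega>"
proof -
  have "{x. box_bump a c n x \<noteq> 0} \<subseteq> cbox a c"
    using box_bump_eq_0[of _ a c n] box_subset_cbox by blast
  then have "closure {x. box_bump a c n x \<noteq> 0} \<subseteq> cbox a c"
    by (rule closure_minimal) (rule closed_cbox)
  moreover from this have "compact (closure {x. box_bump a c n x \<noteq> 0})"
    by (meson bounded_cbox bounded_subset closed_closure compact_eq_bounded_closed)
  ultimately show ?thesis
    using assms C_k_box_bump unfolding test_functions_def by blast
qed

lemma exp_flat_1_bounds: "0 \<le> exp_flat 1 t" "exp_flat 1 t \<le> 1"
  by (auto simp: exp_flat_def)

lemma box_bump_bounds: "0 \<le> box_bump a c n x" "box_bump a c n x \<le> 1"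
  unfolding box_bump_def
  by (intro prod_nonneg prod_le_1; simp add: exp_flat_1_bounds mult_le_one)+

lemma box_bump_tendsto_indicator:
  "(\<lambda>n. box_bump a c n x) \<longlonglongrightarrow> indicator (box a c) x"
proof (cases "x \<in> box a c")
  case True
  have lim: "(\<lambda>n. exp_flat 1 (real n * s)) \<longlonglongrightarrow> 1" if "s > 0" for s
  proof (rule Lim_transform_eventually)
    have "(\<lambda>n. 1 / (real n * s)) \<longlonglongrightarrow> 0"
      using tendsto_mult_left[OF lim_1_over_n, of "1 / s"] by (simp add: mult.commute)
    from tendsto_exp[OF tendsto_minus[OF this]]
    show "(\<lambda>n. exp (- (1 / (real n * s)))) \<longlonglongrightarrow> 1"
      by simp
    show "\<forall>\<^sub>F n in sequentially. exp (- (1 / (real n * s))) = exp_flat 1 (real n * s)"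
      using eventually_gt_at_top[of 0] by eventually_elim (simp add: exp_flat_def that)
  qed
  have "(\<lambda>n. box_bump a c n x) \<longlonglongrightarrow> (\<Prod>b\<in>(Basis::'a set). 1 * 1)"
    unfolding box_bump_def
    by (intro tendsto_prod tendsto_mult lim) (use True in \<open>auto simp: mem_box\<close>)
  with True show ?thesis by simp
qed (simp add: box_bump_eq_0)

lemma continuous_box_bump: "continuous_on UNIV (box_bump a c n)"
  using C_k_box_bump[of 0] by simp

section \<open>The fundamental lemma of the calculus of variations\<close>

text \<open>The bumps are bounded by \<open>1\<close> and converge to the indicator of the open box, so dominated
  convergence carries the hypothesis over to that indicator. The boundary of the box is negligible.\<close>

lemma integral_cbox_eq_0_if_weakly_0:
  fixes g :: "'a::euclidean_space \<Rightarrow> 'b::euclidean_space"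
  assumes meas: "\<Omega> \<in> sets lebesgue"
    and g: "integrable (lebesgue_on \<Omega>) g"
    and weak: "\<And>\<phi>. \<phi> \<in> test_functions \<Omega> \<Longrightarrow> integral\<^sup>L (lebesgue_on \<Omega>) (\<lambda>x. \<phi> x *\<^sub>R g x) = 0"
    and sub: "cbox a c \<subseteq> \<Omega>"
  shows "integral (cbox a c) g = 0"
proof -
  have [measurable]: "g \<in> borel_measurable (lebesgue_on \<Omega>)"
    using g by (rule borel_measurable_integrable)
  have [measurable]: "box_bump a c n \<in> borel_measurable (lebesgue_on \<Omega>)" for n
    using continuous_on_subset[OF continuous_box_bump] meas
    by (intro continuous_imp_measurable_on_sets_lebesgue) auto
  have [measurable]: "indicat_real (box a c) \<in> borel_measurable (lebesgue_on \<Omega>)"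
    by (intro measurable_restrict_space1 borel_measurable_indicator) simp
  have bound: "norm (box_bump a c n x *\<^sub>R g x) \<le> norm (g x)" for n x
    using box_bump_bounds[of a c n x] by (simp add: mult_left_le_one_le)
  have dom: "integrable (lebesgue_on \<Omega>) (\<lambda>x. norm (g x))"
    using g by (rule integrable_norm)
  have "(\<lambda>n. integral\<^sup>L (lebesgue_on \<Omega>) (\<lambda>x. box_bump a c n x *\<^sub>R g x)) \<longlonglongrightarrow>
      integral\<^sup>L (lebesgue_on \<Omega>) (\<lambda>x. indicator (box a c) x *\<^sub>R g x)"
  proof (rule integral_dominated_convergence[OF _ _ dom])
    show "AE x in lebesgue_on \<Omega>. norm (box_bump a c n x *\<^sub>R g x) \<le> norm (g x)" for n
      by (intro AE_I2 bound)
  qed (auto intro!: tendsto_scaleR box_bump_tendsto_indicator)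
  moreover have "integral\<^sup>L (lebesgue_on \<Omega>) (\<lambda>x. box_bump a c n x *\<^sub>R g x) = 0" for n
    using weak[OF box_bump_test_function[OF sub]] .
  ultimately have zero: "integral\<^sup>L (lebesgue_on \<Omega>) (\<lambda>x. indicator (box a c) x *\<^sub>R g x) = 0"
    by (simp add: LIMSEQ_const_iff)
  have box: "box a c \<subseteq> \<Omega>"
    using sub box_subset_cbox by blast
  have int: "integrable (lebesgue_on \<Omega>) (\<lambda>x. indicator (box a c) x *\<^sub>R g x)"
  proof (rule Bochner_Integration.integrable_bound[OF g])
    show "AE x in lebesgue_on \<Omega>. norm (indicat_real (box a c) x *\<^sub>R g x) \<le> norm (g x)"
      by (intro AE_I2) (simp add: indicator_def)
  qed measurable
  have "integral (cbox a c) g = integral (box a c) g"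
    by (rule integral_open_interval[symmetric])
  also have "\<dots> = integral \<Omega> (\<lambda>x. if x \<in> box a c then g x else 0)"
    using box by (metis Henstock_Kurzweil_Integration.integral_restrict_Int inf.absorb1)
  also have "(\<lambda>x. if x \<in> box a c then g x else 0) = (\<lambda>x. indicator (box a c) x *\<^sub>R g x)"
    by (auto simp: indicator_def)
  also have "integral \<Omega> (\<lambda>x. indicator (box a c) x *\<^sub>R g x) = 0"
    using lebesgue_integral_eq_integral[OF int meas] zero by simp
  finally show ?thesis .
qed

text \<open>Almost every value of \<open>g\<close> is the limit of its averages over shrinking boxes with a corner at that
  point. In an open set, those boxes eventually lie inside, where the averages are \<open>0\<close>.\<close>

lemma AE_eq_0_if_weakly_0:
  fixes g :: "'a::euclidean_space \<Rightarrow> 'b::euclidean_space"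
  assumes "open \<Omega>"
    and g: "integrable (lebesgue_on \<Omega>) g"
    and weak: "\<And>\<phi>. \<phi> \<in> test_functions \<Omega> \<Longrightarrow> integral\<^sup>L (lebesgue_on \<Omega>) (\<lambda>x. \<phi> x *\<^sub>R g x) = 0"
  shows "AE x in lebesgue_on \<Omega>. g x = 0"
proof -
  have meas: "\<Omega> \<in> sets lebesgue"
    using \<open>open \<Omega>\<close> by (simp add: lmeasurable_open borel_open)
  define f where "f x = (if x \<in> \<Omega> then g x else 0)" for x
  have "g integrable_on \<Omega>"
    by (rule integrable_on_lebesgue_on[OF g meas])
  then have "f integrable_on cbox a b" for a b
    unfolding f_def using integrable_altD(1) by blast
  then obtain N where N: "negligible N" and
    avg: "\<And>x e. x \<notin> N \<Longrightarrow> 0 < e \<Longrightarrow> \<exists>d>0. \<forall>h. 0 < h \<and> h < d \<longrightarrow>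
      norm (integral (cbox x (x + h *\<^sub>R One)) f /\<^sub>R h ^ DIM('a) - f x) < e"
    using integrable_ccontinuous_explicit[of f] by metis
  have "g x = 0" if x: "x \<in> \<Omega>" "x \<notin> N" for x
  proof (rule ccontr)
    assume "g x \<noteq> 0"
    then obtain d where d: "d > 0" "\<And>h. 0 < h \<Longrightarrow> h < d \<Longrightarrow>
        norm (integral (cbox x (x + h *\<^sub>R One)) f /\<^sub>R h ^ DIM('a) - f x) < norm (g x)"
      using avg[OF x(2), of "norm (g x)"] by auto
    obtain r where r: "r > 0" "ball x r \<subseteq> \<Omega>"
      using \<open>open \<Omega>\<close> x(1) openE by blast
    \<comment> \<open>A cube of side \<open>h\<close> has \<open>L\<^sup>1\<close> diameter \<open>DIM('a) * h\<close>, which bounds its Euclidean diameter.\<close>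
    define h where "h = min (d / 2) (r / (2 * DIM('a)))"
    have h: "0 < h" "h < d" "DIM('a) * h < r"
      using d(1) r(1) by (auto simp: h_def min_def field_simps)
    have sub: "cbox x (x + h *\<^sub>R One) \<subseteq> \<Omega>"
    proof
      fix y assume y: "y \<in> cbox x (x + h *\<^sub>R One)"
      have "norm (y - x) \<le> (\<Sum>b\<in>Basis. \<bar>(y - x) \<bullet> b\<bar>)"
        by (rule norm_le_l1)
      also have "\<dots> \<le> (\<Sum>b\<in>(Basis :: 'a set). h)"
        using y by (intro sum_mono) (auto simp: mem_box inner_diff_left inner_add_left abs_le_iff algebra_simps)
      also have "\<dots> < r"
        using h(3) by simp
      finally show "y \<in> \<Omega>"
        using r(2) by (auto simp: dist_norm norm_minus_commute)
    qed
    have "integral (cbox x (x + h *\<^sub>R One)) f = integral (cbox x (x + h *\<^sub>R One)) g"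
      using sub by (intro integral_cong) (auto simp: f_def)
    also have "\<dots> = 0"
      by (rule integral_cbox_eq_0_if_weakly_0[OF meas g weak sub])
    finally show False
      using d(2)[OF h(1,2)] x(1) by (simp add: f_def)
  qed
  then have "{x \<in> \<Omega>. g x \<noteq> 0} \<subseteq> N" by blast
  then have "AE x in lebesgue. x \<in> \<Omega> \<longrightarrow> g x = 0"
    using N by (intro AE_I'[of N]) (auto simp: negligible_iff_null_sets)
  then show ?thesis
    using meas by (simp add: AE_restrict_space_iff)
qed

section \<open>Test functions and integration by parts\<close>

text \<open>By translation invariance, every difference quotient of \<open>f\<close> in direction \<open>b\<close> has integral zero.
  The mean value theorem and the bounded support give a common bound with bounded support, so
  dominated convergence passes to the derivative.\<close>

lemma integral_partial_deriv_eq_0: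
  fixes f :: "'a::euclidean_space \<Rightarrow> real"
  assumes diff: "\<And>x. f differentiable (at x)"
    and cont: "continuous_on UNIV (partial_deriv b f)"
    and bounded: "bounded {x. f x \<noteq> 0}"
  shows "integral\<^sup>L lborel (partial_deriv b f) = 0"
proof -
  obtain R where R: "\<And>x. f x \<noteq> 0 \<Longrightarrow> norm x \<le> R"
    using bounded by (auto simp: bounded_iff)
  define K :: "'a set" where "K = cball 0 (R + norm b)"
  have cont_f: "continuous_on UNIV f"
    by (simp add: diff differentiable_imp_continuous_within continuous_on_eq_continuous_within)
  have int_f: "integrable lborel f"
  proof -
    have "integrable lborel (\<lambda>x. indicator (cball 0 R) x *\<^sub>R f x)"
      by (intro borel_integrable_compact continuous_on_subset[OF cont_f]) auto
    also have "(\<lambda>x. indicator (cball 0 R) x *\<^sub>R f x) = f"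
      using R by (auto simp: indicator_def fun_eq_iff)
    finally show ?thesis .
  qed
  have "compact (partial_deriv b f ` cball 0 (R + 2 * norm b))"
    by (intro compact_continuous_image continuous_on_subset[OF cont]) auto
  then obtain C where C: "\<And>x. norm x \<le> R + 2 * norm b \<Longrightarrow> \<bar>partial_deriv b f x\<bar> \<le> C"
    by (auto dest!: compact_imp_bounded simp: bounded_iff) (metis mem_cball_0)
  \<comment> \<open>The difference quotient with step \<open>1 / (n + 1)\<close>; the steps are at most \<open>1\<close>, so that
    \<open>K\<close> contains all points where a quotient can be nonzero.\<close>
  define q where "q n x = (f (inverse (Suc n) *\<^sub>R b + x) - f x) * Suc n" for n :: nat and x
  have deriv: "((\<lambda>s. f (s *\<^sub>R b + x)) has_real_derivative partial_deriv b f (t *\<^sub>R b + x)) (at t)" for x t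
  proof -
    have "((\<lambda>s. f (s *\<^sub>R b + x)) has_derivative
        (\<lambda>s. frechet_derivative f (at (t *\<^sub>R b + x)) (s *\<^sub>R b))) (at t)"
      by (rule has_derivative_compose[of "\<lambda>s. s *\<^sub>R b + x" "\<lambda>s. s *\<^sub>R b"])
        (auto intro!: derivative_eq_intros diff simp flip: frechet_derivative_works)
    also have "(\<lambda>s. frechet_derivative f (at (t *\<^sub>R b + x)) (s *\<^sub>R b)) = (*) (partial_deriv b f (t *\<^sub>R b + x))"
      using linear_frechet_derivative[OF diff]
      by (auto simp: partial_deriv_def linear_cmul mult.commute)
    finally show ?thesis
      by (simp add: has_field_derivative_def)
  qed
  have bound: "norm (q n x) \<le> indicator K x *\<^sub>R C" for n x
  proof (cases "x \<in> K")
    case True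
    define h where "h = inverse (real (Suc n))"
    have h: "0 < h" "h \<le> 1"
      by (auto simp: h_def field_simps)
    obtain z where z: "0 < z" "z < h" "f (h *\<^sub>R b + x) - f (0 *\<^sub>R b + x) = (h - 0) * partial_deriv b f (z *\<^sub>R b + x)"
      using MVT2[OF h(1), of "\<lambda>s. f (s *\<^sub>R b + x)" "\<lambda>s. partial_deriv b f (s *\<^sub>R b + x)", OF deriv]
      by metis
    have "q n x = partial_deriv b f (z *\<^sub>R b + x)"
      using z(3) h by (simp add: q_def flip: h_def) (simp add: h_def)
    moreover have "norm (z *\<^sub>R b + x) \<le> R + 2 * norm b"
    proof -
      have "norm (z *\<^sub>R b) \<le> norm b"
        using z h by (simp add: mult_left_le_one_le)
      then show ?thesis
        using True norm_triangle_ineq[of "z *\<^sub>R b" x] by (simp add: K_def)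
    qed
    ultimately show ?thesis
      using C True by simp
  next
    case False
    have far: "R + norm b < norm x"
      using False by (simp add: K_def)
    have "norm (inverse (Suc n) *\<^sub>R b) \<le> norm b"
      by (simp add: field_simps)
    moreover have "norm x - norm (inverse (Suc n) *\<^sub>R b) \<le> norm (inverse (Suc n) *\<^sub>R b + x)"
      by (metis add.commute norm_diff_ineq)
    ultimately have "norm (inverse (Suc n) *\<^sub>R b + x) > R" "norm x > R"
      using far norm_ge_zero[of b] by linarith+
    then have "f (inverse (Suc n) *\<^sub>R b + x) = 0" "f x = 0"
      using R by (meson linorder_not_le)+
    then have "q n x = 0"
      unfolding q_def by simp
    then show ?thesis
      using False by simp
  qed
  have lim: "(\<lambda>n. q n x) \<longlonglongrightarrow> partial_deriv b f x" for x
  proof -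
    have "(\<lambda>h. (f (h *\<^sub>R b + x) - f x) / h) \<midarrow>0\<rightarrow> partial_deriv b f x"
      using deriv[of x 0] by (simp add: DERIV_def)
    moreover have "filterlim (\<lambda>n. inverse (real (Suc n))) (at 0) sequentially"
      using LIMSEQ_inverse_real_of_nat by (simp add: filterlim_at)
    ultimately have "(\<lambda>n. (f (inverse (real (Suc n)) *\<^sub>R b + x) - f x) / inverse (real (Suc n)))
        \<longlonglongrightarrow> partial_deriv b f x"
      by (rule filterlim_compose)
    then show ?thesis
      by (simp add: q_def divide_inverse)
  qed
  have [measurable]: "f \<in> borel_measurable borel" "partial_deriv b f \<in> borel_measurable borel"
    using cont cont_f by (simp_all add: borel_measurable_continuous_onI)
  have shift: "integrable lborel (\<lambda>x. f (a + x))" "integral\<^sup>L lborel (\<lambda>x. f (a + x)) = integral\<^sup>L lborel f" for a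
    using integrable_distr_eq[of "(+) a" lborel borel f] integral_distr[of "(+) a" lborel borel f] int_f
    by (simp_all add: lborel_distr_plus)
  have "(\<lambda>n. integral\<^sup>L lborel (q n)) \<longlonglongrightarrow> integral\<^sup>L lborel (partial_deriv b f)"
  proof (rule integral_dominated_convergence)
    show "integrable lborel (\<lambda>x. indicator K x *\<^sub>R C)"
      by (intro borel_integrable_compact) (auto simp: K_def)
    show "q n \<in> borel_measurable lborel" for n
      unfolding q_def[abs_def] by measurable
  qed (use bound lim in auto)
  moreover have "integral\<^sup>L lborel (q n) = 0" for n
    unfolding q_def[abs_def] using shift int_f by simp
  ultimately show ?thesis
    by (simp add: LIMSEQ_const_iff)
qed

lemma test_function_props:
  assumes "\<phi> \<in> test_functions \<Omega>"
  shows test_function_differentiable: "\<phi> differentiable (at x)"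
    and test_function_continuous: "continuous_on UNIV \<phi>"
    and test_function_continuous_partial: "b \<in> Basis \<Longrightarrow> continuous_on UNIV (partial_deriv b \<phi>)"
    and test_function_bounded_support: "bounded {x. \<phi> x \<noteq> 0}"
    and test_function_eq_0: "y \<notin> \<Omega> \<Longrightarrow> \<phi> y = 0"
proof -
  have C: "C_k k \<phi>" for k
    using assms by (simp add: test_functions_def)
  show "\<phi> differentiable (at x)" "continuous_on UNIV \<phi>"
    "b \<in> Basis \<Longrightarrow> continuous_on UNIV (partial_deriv b \<phi>)"
    using C[of 0] C[of "Suc 0"] by auto
  have "bounded (closure {x. \<phi> x \<noteq> 0})" "closure {x. \<phi> x \<noteq> 0} \<subseteq> \<Omega>"
    using assms by (auto simp: test_functions_def compact_imp_bounded)
  then show "bounded {x. \<phi> x \<noteq> 0}" "y \<notin> \<Omega> \<Longrightarrow> \<phi> y = 0"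
    using closure_subset[of "{x. \<phi> x \<noteq> 0}"] bounded_subset by blast+
qed

lemma test_function_cmult:
  assumes "\<phi> \<in> test_functions \<Omega>"
  shows "(\<lambda>x. c * \<phi> x) \<in> test_functions \<Omega>"
proof -
  have "C_k k (\<lambda>x. c * \<phi> x)" for k
  proof (rule C_k_coinduct)
    show "(\<lambda>x. c * \<phi> x) \<in> {\<lambda>x. c * f x | f. \<forall>k. C_k k f}"
      using assms by (auto simp: test_functions_def)
  next
    fix g :: "'a \<Rightarrow> real"
    assume "g \<in> {\<lambda>x. c * f x | f. \<forall>k. C_k k f}"
    then obtain f where g: "g = (\<lambda>x. c * f x)" and f: "\<And>k. C_k k f"
      by blast
    have diff: "f differentiable (at x)" for x
      using f[of "Suc 0"] by simp
    have "C_k k (partial_deriv b f)" if "b \<in> Basis" for b k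
      using f[of "Suc k"] that by simp
    moreover have "partial_deriv b g = (\<lambda>x. c * partial_deriv b f x)" for b
      unfolding g partial_deriv_def[of b f]
      by (intro partial_deriv_eqI has_derivative_mult_right) (simp add: diff flip: frechet_derivative_works)
    ultimately show "(\<forall>x. g differentiable (at x)) \<and>
        (\<forall>b\<in>Basis. partial_deriv b g \<in> {\<lambda>x. c * f x | f. \<forall>k. C_k k f})"
      using diff by (auto simp: g)
  qed
  moreover have sub: "closure {x. c * \<phi> x \<noteq> 0} \<subseteq> closure {x. \<phi> x \<noteq> 0}"
    by (intro closure_mono) auto
  moreover have "compact (closure {x. \<phi> x \<noteq> 0})" "closure {x. \<phi> x \<noteq> 0} \<subseteq> \<Omega>"
    using assms by (auto simp: test_functions_def)
  moreover from this have "compact (closure {x. c * \<phi> x \<noteq> 0})"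
    using sub by (meson bounded_subset closed_closure compact_eq_bounded_closed)
  ultimately show ?thesis
    unfolding test_functions_def by blast
qed

text \<open>Integration by parts: the derivative of the compactly supported product \<open>\<psi> \<phi>\<close> integrates to
  zero over the whole space, and it vanishes outside \<open>\<Omega>\<close>.\<close>

lemma is_weak_grad_grad:
  fixes \<psi> :: "'a::euclidean_space \<Rightarrow> real"
  assumes meas: "\<Omega> \<in> sets lebesgue" and \<psi>: "\<psi> \<in> test_functions \<Omega>"
    and int: "\<And>\<phi>. \<phi> \<in> test_functions \<Omega> \<Longrightarrow> integrable (lebesgue_on \<Omega>) (\<lambda>x. \<psi> x *\<^sub>R grad \<phi> x)"
      "\<And>\<phi>. \<phi> \<in> test_functions \<Omega> \<Longrightarrow> integrable (lebesgue_on \<Omega>) (\<lambda>x. \<phi> x *\<^sub>R grad \<psi> x)"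
  shows "is_weak_grad \<Omega> \<psi> (grad \<psi>)"
  unfolding is_weak_grad_def
proof
  fix \<phi> assume \<phi>: "\<phi> \<in> test_functions \<Omega>"
  note int = int[OF \<phi>]
  let ?p = "\<lambda>b. partial_deriv b (\<lambda>x. \<psi> x * \<phi> x)"
  have p: "?p b = (\<lambda>x. \<psi> x * partial_deriv b \<phi> x + partial_deriv b \<psi> x * \<phi> x)" for b
    using \<phi> \<psi> by (intro partial_deriv_mult test_function_differentiable)
  have cont: "continuous_on UNIV (?p b)" if "b \<in> Basis" for b
    unfolding p using that \<phi> \<psi>
    by (intro continuous_intros test_function_continuous test_function_continuous_partial)
  have zero: "integral\<^sup>L lborel (?p b) = 0" if "b \<in> Basis" for b
  proof (rule integral_partial_deriv_eq_0[OF _ cont[OF that]])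
    show "(\<lambda>x. \<psi> x * \<phi> x) differentiable (at x)" for x
      using \<phi> \<psi> by (intro differentiable_mult test_function_differentiable)
    show "bounded {x. \<psi> x * \<phi> x \<noteq> 0}"
      by (rule bounded_subset[OF test_function_bounded_support[OF \<phi>]]) auto
  qed
  have "integral\<^sup>L (lebesgue_on \<Omega>) (\<lambda>x. \<psi> x *\<^sub>R grad \<phi> x) + integral\<^sup>L (lebesgue_on \<Omega>) (\<lambda>x. \<phi> x *\<^sub>R grad \<psi> x)
      = integral\<^sup>L (lebesgue_on \<Omega>) (\<lambda>x. \<psi> x *\<^sub>R grad \<phi> x + \<phi> x *\<^sub>R grad \<psi> x)"
    by (rule Bochner_Integration.integral_add[OF int, symmetric])
  also have "\<dots> = 0"
  proof (rule euclidean_eqI)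
    fix b :: 'a assume b: "b \<in> Basis"
    have "integral\<^sup>L (lebesgue_on \<Omega>) (\<lambda>x. \<psi> x *\<^sub>R grad \<phi> x + \<phi> x *\<^sub>R grad \<psi> x) \<bullet> b =
        integral\<^sup>L (lebesgue_on \<Omega>) (\<lambda>x. (\<psi> x *\<^sub>R grad \<phi> x + \<phi> x *\<^sub>R grad \<psi> x) \<bullet> b)"
      using int by (intro integral_inner_left[symmetric] Bochner_Integration.integrable_add)
    also have "(\<lambda>x. (\<psi> x *\<^sub>R grad \<phi> x + \<phi> x *\<^sub>R grad \<psi> x) \<bullet> b) = ?p b"
      using b by (auto simp: p grad_def inner_add_left inner_sum_left_Basis)
    also have "integral\<^sup>L (lebesgue_on \<Omega>) (?p b) = integral\<^sup>L lebesgue (\<lambda>x. indicator \<Omega> x *\<^sub>R ?p b x)"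
      using meas by (intro integral_restrict_space) simp
    also have "(\<lambda>x. indicator \<Omega> x *\<^sub>R ?p b x) = ?p b"
      using test_function_eq_0[OF \<phi>] test_function_eq_0[OF \<psi>]
      by (auto simp: p indicator_def fun_eq_iff)
    also have "integral\<^sup>L lebesgue (?p b) = integral\<^sup>L lborel (?p b)"
      using cont[OF b] by (intro integral_completion) (simp add: borel_measurable_continuous_onI)
    finally show "integral\<^sup>L (lebesgue_on \<Omega>) (\<lambda>x. \<psi> x *\<^sub>R grad \<phi> x + \<phi> x *\<^sub>R grad \<psi> x) \<bullet> b = 0 \<bullet> b"
      using zero[OF b] by simp
  qed
  finally show "integral\<^sup>L (lebesgue_on \<Omega>) (\<lambda>x. \<psi> x *\<^sub>R grad \<phi> x) =
      - integral\<^sup>L (lebesgue_on \<Omega>) (\<lambda>x. \<phi> x *\<^sub>R grad \<psi> x)"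
    by (simp add: eq_neg_iff_add_eq_0)
qed

section \<open>Square integrable functions and weak gradients\<close>

lemma L2_space_integrable_inner:
  assumes "f \<in> L2_space \<Omega>" "g \<in> L2_space \<Omega>"
  shows "integrable (lebesgue_on \<Omega>) (\<lambda>x. f x \<bullet> g x)"
proof (rule Bochner_Integration.integrable_bound)
  show "integrable (lebesgue_on \<Omega>) (\<lambda>x. (norm (f x))\<^sup>2 + (norm (g x))\<^sup>2)"
    using assms by (simp add: L2_space_def)
  show "(\<lambda>x. f x \<bullet> g x) \<in> borel_measurable (lebesgue_on \<Omega>)"
    using assms by (auto simp: L2_space_def)
  have "\<bar>a \<bullet> b\<bar> \<le> (norm a)\<^sup>2 + (norm b)\<^sup>2" for a b :: 'b
    using Cauchy_Schwarz_ineq2[of a b] sum_squares_bound[of "norm a" "norm b"]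
      mult_nonneg_nonneg[OF norm_ge_zero norm_ge_zero, of a b] by linarith
  then show "AE x in lebesgue_on \<Omega>. norm (f x \<bullet> g x) \<le> norm ((norm (f x))\<^sup>2 + (norm (g x))\<^sup>2)"
    by (intro AE_I2) simp
qed

lemma L2_space_integrable_scaleR:
  fixes u :: "'a::euclidean_space \<Rightarrow> real"
  assumes "u \<in> L2_space \<Omega>" "g \<in> L2_space \<Omega>"
  shows "integrable (lebesgue_on \<Omega>) (\<lambda>x. u x *\<^sub>R g x)"
proof (rule Bochner_Integration.integrable_bound)
  show "integrable (lebesgue_on \<Omega>) (\<lambda>x. (norm (u x))\<^sup>2 + (norm (g x))\<^sup>2)"
    using assms by (simp add: L2_space_def)
  show "(\<lambda>x. u x *\<^sub>R g x) \<in> borel_measurable (lebesgue_on \<Omega>)"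
    using assms by (auto simp: L2_space_def)
  have "a * b \<le> a\<^sup>2 + b\<^sup>2" if "0 \<le> a" "0 \<le> b" for a b :: real
    using sum_squares_bound[of a b] mult_nonneg_nonneg[OF that] by linarith
  from this[OF abs_ge_zero norm_ge_zero]
  have "\<bar>u x\<bar> * norm (g x) \<le> (u x)\<^sup>2 + (norm (g x))\<^sup>2" for x
    by (metis power2_abs)
  then show "AE x in lebesgue_on \<Omega>. norm (u x *\<^sub>R g x) \<le> norm ((norm (u x))\<^sup>2 + (norm (g x))\<^sup>2)"
    by (intro AE_I2) simp
qed

lemma norm_diff_scaleR_squared:
  fixes a b :: "'b::real_inner"
  shows "(norm (a - t *\<^sub>R b))\<^sup>2 = (norm a)\<^sup>2 - 2 * t * (a \<bullet> b) + t\<^sup>2 * (norm b)\<^sup>2"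
  by (simp add: power2_norm_eq_inner inner_diff_left inner_diff_right inner_commute[of b a]
      power2_eq_square[of t] algebra_simps)

lemma L2_space_diff_scaleR:
  assumes "f \<in> L2_space \<Omega>" "g \<in> L2_space \<Omega>"
  shows "(\<lambda>x. f x - t *\<^sub>R g x) \<in> L2_space \<Omega>"
proof -
  have "(\<lambda>x. f x - t *\<^sub>R g x) \<in> borel_measurable (lebesgue_on \<Omega>)"
    using assms unfolding L2_space_def by (intro borel_measurable_diff borel_measurable_scaleR) auto
  moreover have "integrable (lebesgue_on \<Omega>)
      (\<lambda>x. (norm (f x))\<^sup>2 - 2 * t * (f x \<bullet> g x) + t\<^sup>2 * (norm (g x))\<^sup>2)"
    using assms L2_space_integrable_inner[OF assms] unfolding L2_space_def
    by (intro Bochner_Integration.integrable_add Bochner_Integration.integrable_diff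
        integrable_mult_right) auto
  ultimately show ?thesis
    by (simp add: L2_space_def norm_diff_scaleR_squared)
qed

lemma L2_norm_squared: "(L2_norm \<Omega> f)\<^sup>2 = integral\<^sup>L (lebesgue_on \<Omega>) (\<lambda>x. (norm (f x))\<^sup>2)"
  by (simp add: L2_norm_def)

lemma L2_norm_squared_diff_scaleR:
  assumes "f \<in> L2_space \<Omega>" "g \<in> L2_space \<Omega>"
  shows "(L2_norm \<Omega> (\<lambda>x. f x - t *\<^sub>R g x))\<^sup>2 =
    (L2_norm \<Omega> f)\<^sup>2 - 2 * t * integral\<^sup>L (lebesgue_on \<Omega>) (\<lambda>x. f x \<bullet> g x) + t\<^sup>2 * (L2_norm \<Omega> g)\<^sup>2"
proof -
  have "integrable (lebesgue_on \<Omega>) (\<lambda>x. (norm (f x))\<^sup>2)" "integrable (lebesgue_on \<Omega>) (\<lambda>x. (norm (g x))\<^sup>2)"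
    using assms by (simp_all add: L2_space_def)
  then show ?thesis
    using L2_space_integrable_inner[OF assms]
    by (simp add: L2_norm_squared norm_diff_scaleR_squared)
qed

lemma L2_norm_cong_AE:
  assumes "f \<in> L2_space \<Omega>" "g \<in> L2_space \<Omega>" "AE x in lebesgue_on \<Omega>. f x = g x"
  shows "L2_norm \<Omega> f = L2_norm \<Omega> g"
proof -
  have "AE x in lebesgue_on \<Omega>. (norm (f x))\<^sup>2 = (norm (g x))\<^sup>2"
    using assms(3) by eventually_elim simp
  then show ?thesis
    using assms(1,2) unfolding L2_norm_def L2_space_def
    by (intro arg_cong[where f = sqrt] integral_cong_AE) auto
qed

lemma continuous_imp_L2_space:
  fixes f :: "'a::euclidean_space \<Rightarrow> 'b::euclidean_space"
  assumes "open \<Omega>" "bounded \<Omega>" "continuous_on UNIV f"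
  shows "f \<in> L2_space \<Omega>"
proof -
  have lm: "\<Omega> \<in> lmeasurable"
    using assms by (simp add: lmeasurable_open)
  interpret finite_measure "lebesgue_on \<Omega>"
    using lm by (rule finite_measure_lebesgue_on)
  have cont: "continuous_on UNIV (\<lambda>x. (norm (f x))\<^sup>2)"
    using assms(3) by (intro continuous_intros)
  have meas: "h \<in> borel_measurable (lebesgue_on \<Omega>)" if "continuous_on UNIV h" for h :: "'a \<Rightarrow> 'c::euclidean_space"
    using lm continuous_on_subset[OF that, of \<Omega>]
    by (intro continuous_imp_measurable_on_sets_lebesgue) (auto simp: fmeasurableD)
  have "compact ((\<lambda>x. (norm (f x))\<^sup>2) ` closure \<Omega>)"
    using assms(2) by (intro compact_continuous_image continuous_on_subset[OF cont]) auto
  then obtain B where B: "\<And>x. x \<in> closure \<Omega> \<Longrightarrow> norm ((norm (f x))\<^sup>2) \<le> B"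
    by (meson bounded_iff compact_imp_bounded imageI)
  have "integrable (lebesgue_on \<Omega>) (\<lambda>x. (norm (f x))\<^sup>2)"
  proof (rule integrable_const_bound[where B = B])
    show "AE x in lebesgue_on \<Omega>. norm ((norm (f x))\<^sup>2) \<le> B"
      using B closure_subset[of \<Omega>] by (intro AE_I2) (auto simp: subset_iff)
  qed (rule meas[OF cont])
  then show ?thesis
    using meas[OF assms(3)] by (simp add: L2_space_def)
qed

lemma continuous_grad_test_function:
  "\<phi> \<in> test_functions \<Omega> \<Longrightarrow> continuous_on UNIV (grad \<phi>)"
  unfolding grad_def[abs_def]
  by (intro continuous_on_sum continuous_on_scaleR continuous_on_const test_function_continuous_partial)

lemma weak_grad_in_L2: "v \<in> H1 \<Omega> \<Longrightarrow> weak_grad \<Omega> v \<in> L2_space \<Omega>"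
  and is_weak_grad_weak_grad: "v \<in> H1 \<Omega> \<Longrightarrow> is_weak_grad \<Omega> v (weak_grad \<Omega> v)"
proof -
  have "weak_grad \<Omega> v \<in> L2_space \<Omega> \<and> is_weak_grad \<Omega> v (weak_grad \<Omega> v)" if "v \<in> H1 \<Omega>"
    unfolding weak_grad_def
    by (rule someI_ex[where P = "\<lambda>G. G \<in> L2_space \<Omega> \<and> is_weak_grad \<Omega> v G"])
      (use that in \<open>auto simp: H1_def\<close>)
  then show "v \<in> H1 \<Omega> \<Longrightarrow> weak_grad \<Omega> v \<in> L2_space \<Omega>"
    "v \<in> H1 \<Omega> \<Longrightarrow> is_weak_grad \<Omega> v (weak_grad \<Omega> v)" by auto
qed

lemma H1_in_L2: "v \<in> H1 \<Omega> \<Longrightarrow> v \<in> L2_space \<Omega>"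
  by (simp add: H1_def)

context
  fixes \<Omega> :: "'a::euclidean_space set"
  assumes opn: "open \<Omega>" and bdd: "bounded \<Omega>"
begin

lemma test_function_in_L2: "\<phi> \<in> test_functions \<Omega> \<Longrightarrow> \<phi> \<in> L2_space \<Omega>"
  and grad_test_function_in_L2: "\<phi> \<in> test_functions \<Omega> \<Longrightarrow> grad \<phi> \<in> L2_space \<Omega>"
  using continuous_imp_L2_space[OF opn bdd] test_function_continuous continuous_grad_test_function
  by blast+

lemma test_function_in_H1:
  assumes "\<psi> \<in> test_functions \<Omega>"
  shows "\<psi> \<in> H1 \<Omega>"
proof -
  have "is_weak_grad \<Omega> \<psi> (grad \<psi>)"
    using opn assms
    by (intro is_weak_grad_grad L2_space_integrable_scaleR test_function_in_L2 grad_test_function_in_L2)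
      (auto simp: borel_open)
  then show ?thesis
    using assms test_function_in_L2 grad_test_function_in_L2 by (auto simp: H1_def)
qed

text \<open>Boundedness of the domain turns square integrability into the integrability that the fundamental
  lemma asks for.\<close>

lemma weak_grad_unique_AE:
  assumes G: "G \<in> L2_space \<Omega>" "is_weak_grad \<Omega> v G"
    and G': "G' \<in> L2_space \<Omega>" "is_weak_grad \<Omega> v G'"
  shows "AE x in lebesgue_on \<Omega>. G x = G' x"
proof -
  have diff: "(\<lambda>x. G x - G' x) \<in> L2_space \<Omega>"
    using L2_space_diff_scaleR[OF G(1) G'(1), of 1] by simp
  have "(\<lambda>x. 1::real) \<in> L2_space \<Omega>"
    using opn bdd by (intro continuous_imp_L2_space) auto
  from L2_space_integrable_scaleR[OF this diff]
  have "integrable (lebesgue_on \<Omega>) (\<lambda>x. G x - G' x)" by simp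
  then have "AE x in lebesgue_on \<Omega>. G x - G' x = 0"
  proof (rule AE_eq_0_if_weakly_0[OF opn])
    fix \<phi> assume \<phi>: "\<phi> \<in> test_functions \<Omega>"
    have "integral\<^sup>L (lebesgue_on \<Omega>) (\<lambda>x. \<phi> x *\<^sub>R G x) = integral\<^sup>L (lebesgue_on \<Omega>) (\<lambda>x. \<phi> x *\<^sub>R G' x)"
      using G(2) G'(2) \<phi> unfolding is_weak_grad_def by (metis neg_equal_iff_equal)
    then show "integral\<^sup>L (lebesgue_on \<Omega>) (\<lambda>x. \<phi> x *\<^sub>R (G x - G' x)) = 0"
      using L2_space_integrable_scaleR[OF test_function_in_L2[OF \<phi>] G(1)]
        L2_space_integrable_scaleR[OF test_function_in_L2[OF \<phi>] G'(1)]
      by (simp add: scaleR_diff_right Bochner_Integration.integral_diff)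
  qed
  then show ?thesis by simp
qed

lemma is_weak_grad_diff_scaleR:
  assumes u: "u \<in> L2_space \<Omega>" "G \<in> L2_space \<Omega>" "is_weak_grad \<Omega> u G"
    and w: "w \<in> L2_space \<Omega>" "H \<in> L2_space \<Omega>" "is_weak_grad \<Omega> w H"
  shows "is_weak_grad \<Omega> (\<lambda>x. u x - t * w x) (\<lambda>x. G x - t *\<^sub>R H x)"
  unfolding is_weak_grad_def
proof
  fix \<phi> assume \<phi>: "\<phi> \<in> test_functions \<Omega>"
  note int = L2_space_integrable_scaleR[OF _ grad_test_function_in_L2[OF \<phi>]]
    L2_space_integrable_scaleR[OF test_function_in_L2[OF \<phi>]]
  have eq: "integral\<^sup>L (lebesgue_on \<Omega>) (\<lambda>x. u x *\<^sub>R grad \<phi> x) = - integral\<^sup>L (lebesgue_on \<Omega>) (\<lambda>x. \<phi> x *\<^sub>R G x)"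
    "integral\<^sup>L (lebesgue_on \<Omega>) (\<lambda>x. w x *\<^sub>R grad \<phi> x) = - integral\<^sup>L (lebesgue_on \<Omega>) (\<lambda>x. \<phi> x *\<^sub>R H x)"
    using u(3) w(3) \<phi> by (auto simp: is_weak_grad_def)
  have "integral\<^sup>L (lebesgue_on \<Omega>) (\<lambda>x. (u x - t * w x) *\<^sub>R grad \<phi> x) =
      integral\<^sup>L (lebesgue_on \<Omega>) (\<lambda>x. u x *\<^sub>R grad \<phi> x - t *\<^sub>R (w x *\<^sub>R grad \<phi> x))"
    by (simp add: scaleR_diff_left)
  also have "\<dots> = integral\<^sup>L (lebesgue_on \<Omega>) (\<lambda>x. u x *\<^sub>R grad \<phi> x) -
      t *\<^sub>R integral\<^sup>L (lebesgue_on \<Omega>) (\<lambda>x. w x *\<^sub>R grad \<phi> x)"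
    using int(1)[OF u(1)] int(1)[OF w(1)]
    by (subst Bochner_Integration.integral_diff) (auto simp del: scaleR_scaleR)
  also have "\<dots> = - (integral\<^sup>L (lebesgue_on \<Omega>) (\<lambda>x. \<phi> x *\<^sub>R G x) -
      t *\<^sub>R integral\<^sup>L (lebesgue_on \<Omega>) (\<lambda>x. \<phi> x *\<^sub>R H x))"
    by (simp add: eq)
  also have "integral\<^sup>L (lebesgue_on \<Omega>) (\<lambda>x. \<phi> x *\<^sub>R G x) -
      t *\<^sub>R integral\<^sup>L (lebesgue_on \<Omega>) (\<lambda>x. \<phi> x *\<^sub>R H x) =
      integral\<^sup>L (lebesgue_on \<Omega>) (\<lambda>x. \<phi> x *\<^sub>R G x - t *\<^sub>R (\<phi> x *\<^sub>R H x))"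
    using int(2)[OF u(2)] int(2)[OF w(2)]
    by (subst Bochner_Integration.integral_diff) (auto simp del: scaleR_scaleR)
  also have "(\<lambda>x. \<phi> x *\<^sub>R G x - t *\<^sub>R (\<phi> x *\<^sub>R H x)) = (\<lambda>x. \<phi> x *\<^sub>R (G x - t *\<^sub>R H x))"
    by (simp add: scaleR_diff_right mult.commute)
  finally show "integral\<^sup>L (lebesgue_on \<Omega>) (\<lambda>x. (u x - t * w x) *\<^sub>R grad \<phi> x) =
      - integral\<^sup>L (lebesgue_on \<Omega>) (\<lambda>x. \<phi> x *\<^sub>R (G x - t *\<^sub>R H x))" .
qed

lemma
  assumes u: "u \<in> H1 \<Omega>" and w: "w \<in> H1 \<Omega>"
  shows H1_diff_scaleR: "(\<lambda>x. u x - t * w x) \<in> H1 \<Omega>"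
    and weak_grad_diff_scaleR: "AE x in lebesgue_on \<Omega>.
      weak_grad \<Omega> (\<lambda>x. u x - t * w x) x = weak_grad \<Omega> u x - t *\<^sub>R weak_grad \<Omega> w x"
proof -
  note G = weak_grad_in_L2 is_weak_grad_weak_grad
  have L2: "(\<lambda>x. weak_grad \<Omega> u x - t *\<^sub>R weak_grad \<Omega> w x) \<in> L2_space \<Omega>"
    using u w by (intro L2_space_diff_scaleR G)
  have weak: "is_weak_grad \<Omega> (\<lambda>x. u x - t * w x) (\<lambda>x. weak_grad \<Omega> u x - t *\<^sub>R weak_grad \<Omega> w x)"
    using u w by (intro is_weak_grad_diff_scaleR H1_in_L2 G)
  have "(\<lambda>x. u x - t * w x) \<in> L2_space \<Omega>"
    using L2_space_diff_scaleR[OF H1_in_L2[OF u] H1_in_L2[OF w], of t] by simp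
  with L2 weak show H1: "(\<lambda>x. u x - t * w x) \<in> H1 \<Omega>"
    by (auto simp: H1_def)
  show "AE x in lebesgue_on \<Omega>.
      weak_grad \<Omega> (\<lambda>x. u x - t * w x) x = weak_grad \<Omega> u x - t *\<^sub>R weak_grad \<Omega> w x"
    by (rule weak_grad_unique_AE[OF G(1)[OF H1] G(2)[OF H1] L2 weak])
qed

end

section \<open>The energy and its expansion\<close>

definition energy :: "'a::euclidean_space set \<Rightarrow> real \<Rightarrow> ('a \<Rightarrow> real) \<Rightarrow> real" where
  "energy \<Omega> \<epsilon> v = \<epsilon>\<^sup>2 * (H1_seminorm \<Omega> v)\<^sup>2 + (L2_norm \<Omega> v)\<^sup>2"

definition energy_form :: "'a::euclidean_space set \<Rightarrow> real \<Rightarrow> ('a \<Rightarrow> real) \<Rightarrow> ('a \<Rightarrow> real) \<Rightarrow> real" where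
  "energy_form \<Omega> \<epsilon> v w = integral\<^sup>L (lebesgue_on \<Omega>)
     (\<lambda>x. \<epsilon>\<^sup>2 * (weak_grad \<Omega> v x \<bullet> weak_grad \<Omega> w x) + v x * w x)"

lemma energy_nonneg: "0 \<le> energy \<Omega> \<epsilon> v"
  by (simp add: energy_def)

lemma energy_form_eq:
  assumes "u \<in> H1 \<Omega>" "w \<in> H1 \<Omega>"
  shows "energy_form \<Omega> \<epsilon> u w =
    \<epsilon>\<^sup>2 * integral\<^sup>L (lebesgue_on \<Omega>) (\<lambda>x. weak_grad \<Omega> u x \<bullet> weak_grad \<Omega> w x) +
    integral\<^sup>L (lebesgue_on \<Omega>) (\<lambda>x. u x * w x)"
  using L2_space_integrable_inner[OF weak_grad_in_L2[OF assms(1)] weak_grad_in_L2[OF assms(2)]]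
    L2_space_integrable_inner[OF H1_in_L2[OF assms(1)] H1_in_L2[OF assms(2)]]
  by (simp add: energy_form_def)

lemma energy_form_self:
  assumes "u \<in> H1 \<Omega>"
  shows "energy_form \<Omega> \<epsilon> u u = energy \<Omega> \<epsilon> u"
  using assms
  by (simp add: energy_form_eq energy_def H1_seminorm_def L2_norm_squared
      flip: power2_norm_eq_inner power2_eq_square)

lemma energy_diff_scaleR:
  assumes "open \<Omega>" "bounded \<Omega>" and u: "u \<in> H1 \<Omega>" and w: "w \<in> H1 \<Omega>"
  shows "energy \<Omega> \<epsilon> (\<lambda>x. u x - t * w x) =
    energy \<Omega> \<epsilon> u - 2 * t * energy_form \<Omega> \<epsilon> u w + t\<^sup>2 * energy \<Omega> \<epsilon> w"
proof -
  note G = weak_grad_in_L2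
  have "H1_seminorm \<Omega> (\<lambda>x. u x - t * w x) = L2_norm \<Omega> (\<lambda>x. weak_grad \<Omega> u x - t *\<^sub>R weak_grad \<Omega> w x)"
    unfolding H1_seminorm_def
    by (rule L2_norm_cong_AE[OF G[OF H1_diff_scaleR[OF assms]] L2_space_diff_scaleR[OF G[OF u] G[OF w]]
          weak_grad_diff_scaleR[OF assms]])
  then have seminorm: "(H1_seminorm \<Omega> (\<lambda>x. u x - t * w x))\<^sup>2 = (H1_seminorm \<Omega> u)\<^sup>2 -
      2 * t * integral\<^sup>L (lebesgue_on \<Omega>) (\<lambda>x. weak_grad \<Omega> u x \<bullet> weak_grad \<Omega> w x) +
      t\<^sup>2 * (H1_seminorm \<Omega> w)\<^sup>2"
    using L2_norm_squared_diff_scaleR[OF G[OF u] G[OF w]] by (simp add: H1_seminorm_def)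
  have norm: "(L2_norm \<Omega> (\<lambda>x. u x - t * w x))\<^sup>2 = (L2_norm \<Omega> u)\<^sup>2 -
      2 * t * integral\<^sup>L (lebesgue_on \<Omega>) (\<lambda>x. u x * w x) + t\<^sup>2 * (L2_norm \<Omega> w)\<^sup>2"
    using L2_norm_squared_diff_scaleR[OF H1_in_L2[OF u] H1_in_L2[OF w]] by simp
  show ?thesis
    unfolding energy_def energy_form_eq[OF u w] seminorm norm by (simp add: algebra_simps)
qed

text \<open>Writing \<open>c u = u - (1 - c) u\<close> obtains homogeneity from the expansion.\<close>

lemma energy_cmult:
  assumes "open \<Omega>" "bounded \<Omega>" and u: "u \<in> H1 \<Omega>"
  shows "energy \<Omega> \<epsilon> (\<lambda>x. c * u x) = c\<^sup>2 * energy \<Omega> \<epsilon> u"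
  using energy_diff_scaleR[OF assms u, of \<epsilon> "1 - c"]
  by (simp add: energy_form_self[OF u] algebra_simps power2_eq_square)

lemma H1_norm_cmult:
  assumes "open \<Omega>" "bounded \<Omega>" "u \<in> H1 \<Omega>"
  shows "H1_norm \<Omega> (\<lambda>x. c * u x) = \<bar>c\<bar> * H1_norm \<Omega> u"
proof -
  have "H1_norm \<Omega> v = sqrt (energy \<Omega> 1 v)" for v
    by (simp add: H1_norm_def energy_def add.commute)
  then show ?thesis
    using energy_cmult[OF assms] by (simp add: real_sqrt_mult)
qed

text \<open>If \<open>\<phi>\<close> approximates \<open>w\<close>, then \<open>c \<phi>\<close> approximates \<open>c w\<close>. Homogeneity of the norm is
  available because \<open>w - \<phi>\<close> belongs to \<open>H\<^sup>1(\<Omega>)\<close>.\<close>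

lemma H1_0_cmult:
  assumes \<Omega>: "open \<Omega>" "bounded \<Omega>" and w: "w \<in> H1_0 \<Omega>"
  shows "(\<lambda>x. c * w x) \<in> H1_0 \<Omega>"
proof -
  have wH1: "w \<in> H1 \<Omega>"
    using w by (simp add: H1_0_def)
  \<comment> \<open>Here too \<open>c w = w - (1 - c) w\<close>.\<close>
  have "(\<lambda>x. c * w x) \<in> H1 \<Omega>"
    using H1_diff_scaleR[OF \<Omega> wH1 wH1, of "1 - c"] by (simp add: algebra_simps)
  moreover have "\<exists>\<phi>\<in>test_functions \<Omega>. H1_norm \<Omega> (\<lambda>x. c * w x - \<phi> x) < \<delta>" if "\<delta> > 0" for \<delta>
  proof -
    have "\<delta> / (\<bar>c\<bar> + 1) > 0"
      using that by simp
    then obtain \<phi> where \<phi>: "\<phi> \<in> test_functions \<Omega>" "H1_norm \<Omega> (\<lambda>x. w x - \<phi> x) < \<delta> / (\<bar>c\<bar> + 1)"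
      using w unfolding H1_0_def by blast
    have "(\<lambda>x. w x - \<phi> x) \<in> H1 \<Omega>"
      using H1_diff_scaleR[OF \<Omega> wH1 test_function_in_H1[OF \<Omega> \<phi>(1)], of 1] by simp
    then have "H1_norm \<Omega> (\<lambda>x. c * (w x - \<phi> x)) = \<bar>c\<bar> * H1_norm \<Omega> (\<lambda>x. w x - \<phi> x)"
      by (rule H1_norm_cmult[OF \<Omega>])
    also have "\<dots> \<le> (\<bar>c\<bar> + 1) * H1_norm \<Omega> (\<lambda>x. w x - \<phi> x)"
      by (intro mult_right_mono) (auto simp: H1_norm_def)
    also have "\<dots> < \<delta>"
      using \<phi>(2) by (simp add: field_simps)
    finally show ?thesis
      using test_function_cmult[OF \<phi>(1), of c] by (auto simp: algebra_simps)
  qed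
  ultimately show ?thesis
    by (simp add: H1_0_def)
qed

text \<open>Moving from \<open>v\<close> along a test direction on which the weak equation fails decreases the energy to
  first order.\<close>

lemma ex_H1_0_energy_less:
  assumes \<Omega>: "open \<Omega>" "bounded \<Omega>" and v: "v \<in> H1 \<Omega>" and "\<not> weak_solution \<Omega> \<epsilon> v"
  obtains w where "w \<in> H1_0 \<Omega>" "energy \<Omega> \<epsilon> (\<lambda>x. v x - w x) < energy \<Omega> \<epsilon> v"
proof -
  obtain \<phi> where \<phi>: "\<phi> \<in> H1_0 \<Omega>" and nz: "energy_form \<Omega> \<epsilon> v \<phi> \<noteq> 0"
    using assms by (auto simp: weak_solution_def energy_form_def)
  define B where "B = energy_form \<Omega> \<epsilon> v \<phi>"
  define E where "E = energy \<Omega> \<epsilon> \<phi>"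
  \<comment> \<open>The minimiser is \<open>t = B / E\<close>. Enlarging the denominator keeps the decrease strict and also
    covers the possibility \<open>E = 0\<close>.\<close>
  define t where "t = B / (E + 1)"
  have E: "E \<ge> 0"
    by (simp add: E_def energy_nonneg)
  have t: "t * (E + 1) = B" "t \<noteq> 0"
    using nz E by (auto simp: t_def B_def)
  have "energy \<Omega> \<epsilon> (\<lambda>x. v x - t * \<phi> x) = energy \<Omega> \<epsilon> v - 2 * t * B + t\<^sup>2 * E"
    using \<phi> unfolding B_def E_def by (intro energy_diff_scaleR \<Omega> v) (simp add: H1_0_def)
  also have "\<dots> = energy \<Omega> \<epsilon> v - t\<^sup>2 * (E + 2)"
    unfolding t(1)[symmetric] by (simp add: power2_eq_square algebra_simps)
  also have "\<dots> < energy \<Omega> \<epsilon> v"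
    using E t(2) by (simp add: zero_less_mult_iff)
  finally show thesis
    using that H1_0_cmult[OF \<Omega> \<phi>] by blast
qed

theorem lemma3p3:
  fixes \<Omega> :: "(real ^ 'd) set" and \<epsilon> :: real and v :: "real ^ 'd \<Rightarrow> real"
  assumes "CARD('d) \<in> {2, 3}"
    and "open \<Omega>" and "connected \<Omega>" and "\<Omega> \<noteq> {}" and "bounded \<Omega>"
    and "polyhedral_boundary \<Omega>" and "lipschitz_boundary \<Omega>"
    and "\<epsilon> > 0"
    and "v \<in> H1 \<Omega>"
    and "\<not> weak_solution \<Omega> \<epsilon> v"
  shows "\<exists>\<gamma>\<in>{0<..<1}.
    (INF w\<in>H1_0 \<Omega>.
       (\<epsilon>\<^sup>2 * (H1_seminorm \<Omega> (\<lambda>x. v x - w x))\<^sup>2 + (L2_norm \<Omega> (\<lambda>x. v x - w x))\<^sup>2) /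
       (\<epsilon>\<^sup>2 * (H1_seminorm \<Omega> v)\<^sup>2 + (L2_norm \<Omega> v)\<^sup>2)) \<le> \<gamma>"
proof -
  define r where "r w = energy \<Omega> \<epsilon> (\<lambda>x. v x - w x) / energy \<Omega> \<epsilon> v" for w
  obtain w where w: "w \<in> H1_0 \<Omega>" "energy \<Omega> \<epsilon> (\<lambda>x. v x - w x) < energy \<Omega> \<epsilon> v"
    using ex_H1_0_energy_less assms by blast
  have "r w < 1"
    using w(2) energy_nonneg[of \<Omega> \<epsilon> "\<lambda>x. v x - w x"] by (simp add: r_def)
  moreover have "(INF w\<in>H1_0 \<Omega>. r w) \<le> r w"
    by (rule cINF_lower[OF _ w(1)])
      (auto simp: r_def energy_nonneg intro!: bdd_belowI2[of _ 0])
  \<comment> \<open>The quotient \<open>r w\<close> may be \<open>0\<close>, whereas \<open>\<gamma>\<close> has to be positive.\<close>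
  ultimately show ?thesis
    by (intro bexI[of _ "max (r w) (1 / 2)"]) (auto simp: r_def energy_def)
qed

end
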